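(* Let $t\in[0,1)$ and let $X\subseteq\mathbb{C}^{\mathbb{N}_0}$ be a translation invariant solid Banach lattice with natural basis which contains $d_1$. Suppose that the right-shift operator $S\in\mathcal{L}(X)$ has the property that the series $\sum_{n=0}^\infty t^nS^nx$ is convergent in $X$ for each $x\in X$. Then $\mathcal{C}_t\in\mathcal{L}(X)$ is a compact operator with spectrum $$\sigma(\mathcal{C}_t;X)=\Lambda\cup\{0\}.$$ Moreover, the fine spectra of $\mathcal{C}_t$ consist of the point spectrum $\sigma_{\mathrm p}(\mathcal{C}_t;X)=\Lambda$ together with $\sigma_{\mathrm c}(\mathcal{C}_t;X)=\{0\}$ and $\sigma_{\mathrm r}(\mathcal{C}_t;X)=\emptyset$.
   Context: Let $\mathbb{N}_0=\{0,1,2,\dots\}$ and $\Lambda:=\{1/(n+1):n\in\mathbb{N}_0\}$. For $t\in[0,1]$ the generalized Cesàro operator $\mathcal{C}_t:\mathbb{C}^{\mathbb{N}_0}\to\mathbb{C}^{\mathbb{N}_0}$ is $(\mathcal{C}_tx)_n=\frac{1}{n+1}\sum_{k=0}^n t^{n-k}x_k$ (with $0^0=1$). When $\mathcal{C}_t(X)\subseteq X$, its restriction to $X$ is also denoted $\mathcal{C}_t$. The right-shift operator is $Sx=(0,x_0,x_1,x_2,\dots)$. For $x\in\mathbb{C}^{\mathbb{N}_0}$ put $|x|=(|x_n|)_n$; $x\le y$ means coordinate-wise order. $\mathbb{C}^{\mathbb{N}_0}$ carries the topology of coordinate-wise convergence. Let $e_n=(\delta_{nk})_{k\ge0}$ and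 $c_{00}=\mathrm{span}\{e_n:n\in\mathbb{N}_0\}$. A solid Banach lattice is a linear subspace $X\subseteq\mathbb{C}^{\mathbb{N}_0}$ with a complete norm $\|\cdot\|_X$ such that: $\|x\|_X\le\|y\|_X$ whenever $x,y\in X$ and $|x|\le|y|$; if $x\in X$, $y\in\mathbb{C}^{\mathbb{N}_0}$ and $|y|\le|x|$, then $y\in X$; $c_{00}\subseteq X$; and the inclusion $X\subseteq\mathbb{C}^{\mathbb{N}_0}$ is continuous. It has natural basis if $(e_n)_{n\ge0}$ is a (Schauder) basis of $X$. It is translation invariant if $S(X)\subseteq X$ (then $S\in\mathcal{L}(X)$ by the closed graph theorem). $d_1:=\{x\in\ell^\infty:\hat x\in\ell^1\}$, where $\hat x:=(\sup_{k\ge n}|x_k|)_{n\ge0}$. $\mathcal{L}(X)$ is the space of continuous linear operators on $X$. For $T\in\mathcal{L}(X)$: $\sigma(T;X)$ is the set of $\lambda\in\mathbb{C}$ with $T-\lambda I$ not invertible in $\mathcal{L}(X)$; $\sigma_{\mathrm p}(T;X)$ is the set of $\lambda$ with $T-\lambda I$ not injective; $\sigma_{\mathrm c}(T;X)$ is the set of $\lambda$ with $T-\lambda I$ injective and range a proper dense subspace of $X$; $\sigma_{\mathrm r}(T;X)$ is the set of $\lambda$ with $T-\lambda I$ injective and range not dense in $X$. *)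

theory Defs
  imports "HOL-Analysis.Analysis" "HOL-Library.Function_Algebras"
begin

text \<open>
  Complex sequences are functions of type \<open>nat \<Rightarrow> complex\<close>, added pointwise through
  \<^theory>\<open>HOL-Library.Function_Algebras\<close>.
\<close>

type_synonym cseq = "nat \<Rightarrow> complex"

definition cscale :: "complex \<Rightarrow> cseq \<Rightarrow> cseq" where
  "cscale c x = (\<lambda>n. c * x n)"

global_interpretation cseq: vector_space cscale
  defines cseq_subspace = "module.subspace cscale"
    and cseq_span = "module.span cscale"
  by unfold_locales (auto simp: cscale_def fun_eq_iff algebra_simps)

definition unit_seq :: "nat \<Rightarrow> cseq" where
  "unit_seq n = (\<lambda>k. if k = n then 1 else 0)"

definition right_shift :: "cseq \<Rightarrow> cseq" where
  "right_shift x = (\<lambda>n. case n of 0 \<Rightarrow> 0 | Suc m \<Rightarrow> x m)"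

definition cesaro :: "real \<Rightarrow> cseq \<Rightarrow> cseq" where
  "cesaro t x = (\<lambda>n. 1 / of_nat (n + 1) * (\<Sum>k\<le>n. of_real t ^ (n - k) * x k))"

definition Lambda :: "complex set" where
  "Lambda = {1 / of_nat (n + 1) | n :: nat. True}"

definition least_decr_majorant :: "cseq \<Rightarrow> nat \<Rightarrow> real" where
  "least_decr_majorant x n = (SUP k\<in>{n..}. cmod (x k))"

text \<open>The boundedness condition makes the suprema above genuine ones.\<close>

definition d1 :: "cseq set" where
  "d1 = {x. bounded (range x) \<and> summable (\<lambda>n. \<bar>least_decr_majorant x n\<bar>)}"

text \<open>
  A normed space of sequences is a carrier \<open>X\<close> with a function \<open>N\<close> of which only the values on \<open>X\<close>
  matter.
\<close>

locale normed_seq_space =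
  fixes X :: "cseq set" and N :: "cseq \<Rightarrow> real"
  assumes subspace_X: "cseq_subspace X"
    and N_nonneg: "x \<in> X \<Longrightarrow> 0 \<le> N x"
    and N_eq_0: "x \<in> X \<Longrightarrow> N x = 0 \<longleftrightarrow> x = 0"
    and N_scale: "x \<in> X \<Longrightarrow> N (cscale c x) = cmod c * N x"
    and N_triangle: "x \<in> X \<Longrightarrow> y \<in> X \<Longrightarrow> N (x + y) \<le> N x + N y"
begin

text \<open>
  The locale \<^locale>\<open>Metric_space\<close> requires nonnegativity and symmetry also outside the carrier, hence
  the irrelevant default value.
\<close>

definition ndist :: "cseq \<Rightarrow> cseq \<Rightarrow> real" where
  "ndist x y = (if x \<in> X \<and> y \<in> X then N (x - y) else 0)"

end

sublocale normed_seq_space \<subseteq> Metric_space X ndist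
proof
  note diff = cseq.subspace_diff[OF subspace_X]
  show "0 \<le> ndist x y" for x y
    by (simp add: ndist_def N_nonneg diff)
  show "ndist x y = ndist y x" for x y
  proof (cases "x \<in> X \<and> y \<in> X")
    case True
    have "y - x = cscale (-1) (x - y)"
      by (simp add: cscale_def fun_eq_iff)
    then have "N (y - x) = cmod (-1) * N (x - y)"
      using True N_scale[of "x - y" "-1"] by (simp only: diff)
    with True show ?thesis
      by (simp add: ndist_def)
  qed (auto simp: ndist_def)
  show "ndist x y = 0 \<longleftrightarrow> x = y" if "x \<in> X" "y \<in> X" for x y
    using that by (simp add: ndist_def N_eq_0 diff)
  show "ndist x z \<le> ndist x y + ndist y z" if "x \<in> X" "y \<in> X" "z \<in> X" for x y z
    using that N_triangle[of "x - y" "y - z"] by (simp add: ndist_def diff)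
qed

context normed_seq_space
begin

text \<open>
  Operators on \<open>X\<close> are represented by functions on all sequences; only their restriction to \<open>X\<close> matters,
  and all notions below depend on this restriction only.
\<close>

definition cont_lin_op :: "(cseq \<Rightarrow> cseq) \<Rightarrow> bool" where
  "cont_lin_op T \<longleftrightarrow>
     T ` X \<subseteq> X \<and>
     (\<forall>x\<in>X. \<forall>y\<in>X. T (x + y) = T x + T y) \<and>
     (\<forall>c. \<forall>x\<in>X. T (cscale c x) = cscale c (T x)) \<and>
     continuous_map mtopology mtopology T"

definition compact_op :: "(cseq \<Rightarrow> cseq) \<Rightarrow> bool" where
  "compact_op T \<longleftrightarrow>
     cont_lin_op T \<and> compactin mtopology (mtopology closure_of (T ` mcball 0 1))"

definition shifted_op :: "(cseq \<Rightarrow> cseq) \<Rightarrow> complex \<Rightarrow> cseq \<Rightarrow> cseq" where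
  "shifted_op T \<mu> x = T x - cscale \<mu> x"

definition invertible_op :: "(cseq \<Rightarrow> cseq) \<Rightarrow> bool" where
  "invertible_op T \<longleftrightarrow>
     cont_lin_op T \<and> (\<exists>R. cont_lin_op R \<and> (\<forall>x\<in>X. R (T x) = x \<and> T (R x) = x))"

definition spectrum :: "(cseq \<Rightarrow> cseq) \<Rightarrow> complex set" where
  "spectrum T = {\<mu>. \<not> invertible_op (shifted_op T \<mu>)}"

definition point_spectrum :: "(cseq \<Rightarrow> cseq) \<Rightarrow> complex set" where
  "point_spectrum T = {\<mu>. \<not> inj_on (shifted_op T \<mu>) X}"

definition continuous_spectrum :: "(cseq \<Rightarrow> cseq) \<Rightarrow> complex set" where
  "continuous_spectrum T =
     {\<mu>. inj_on (shifted_op T \<mu>) X \<and>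
         shifted_op T \<mu> ` X \<subset> X \<and>
         mtopology closure_of (shifted_op T \<mu> ` X) = X}"

definition residual_spectrum :: "(cseq \<Rightarrow> cseq) \<Rightarrow> complex set" where
  "residual_spectrum T =
     {\<mu>. inj_on (shifted_op T \<mu>) X \<and>
         mtopology closure_of (shifted_op T \<mu> ` X) \<noteq> X}"

definition series_converges :: "(nat \<Rightarrow> cseq) \<Rightarrow> bool" where
  "series_converges f \<longleftrightarrow> (\<exists>s. limitin mtopology (\<lambda>m. \<Sum>n<m. f n) s sequentially)"

definition natural_basis :: bool where
  "natural_basis \<longleftrightarrow>
     (\<forall>x\<in>X. \<exists>!a :: nat \<Rightarrow> complex.
        limitin mtopology (\<lambda>m. \<Sum>n<m. cscale (a n) (unit_seq n)) x sequentially)"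

definition translation_invariant :: bool where
  "translation_invariant \<longleftrightarrow> right_shift ` X \<subseteq> X"

end

locale solid_banach_lattice = normed_seq_space +
  assumes complete: "mcomplete"
    and N_mono: "x \<in> X \<Longrightarrow> y \<in> X \<Longrightarrow> (\<And>n. cmod (x n) \<le> cmod (y n)) \<Longrightarrow> N x \<le> N y"
    and solid: "x \<in> X \<Longrightarrow> (\<And>n. cmod (y n) \<le> cmod (x n)) \<Longrightarrow> y \<in> X"
    and c00_subset: "cseq_span (range unit_seq) \<subseteq> X"
    and continuous_inclusion:
      "continuous_map mtopology (product_topology (\<lambda>_. euclidean) UNIV) (\<lambda>x. x)"

end

theory Submission
  imports Defs
begin

text \<open>
  Let \<open>S\<close> be the right shift and put \<open>R = \<Sum>n. t\<^sup>n S\<^sup>n\<close>, the inverse of \<open>I - t S\<close>. The averaging in \<open>cesaro t\<close>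
  is \<open>R\<close> followed by the multiplication \<open>D\<close> by the null sequence \<open>1 / (n + 1)\<close>, so \<open>cesaro t = D R\<close>. The
  convergence hypothesis says that \<open>R\<close>, and hence every power of it, maps \<open>X\<close> into \<open>X\<close>. The power
  \<open>R\<^sup>p\<^sup>+\<^sup>1\<close> has the matrix entries \<open>((n - k + p) choose p) * t ^ (n - k)\<close>; these powers supply all the
  elements of \<open>X\<close> that the proof needs.

  All continuity statements come from one principle, \<open>order_bounded_imp_norm_bounded\<close>: a homogeneous map
  of a complete solid space into itself that sends order intervals into order intervals is norm
  bounded. It applies to \<open>R\<close>, to \<open>cesaro t\<close>, and to the inverse operators below. Compactness holds
  because \<open>D\<close> is the norm limit of its finite sections
  (\<open>null_multiplier_compact\<close>).

  For the spectrum, \<open>cesaro t\<close> is lower triangular with diagonal entries \<open>1 / (n + 1)\<close>, so only elements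
  of \<open>Lambda\<close> can be eigenvalues. They are: \<open>R\<^sup>n\<^sup>+\<^sup>1\<close> applied to the unit sequence \<open>e\<^sub>n\<close> is an eigenvector in \<open>X\<close>
  (\<open>cesaro_eigenvector\<close>). For \<open>\<mu>\<close> outside \<open>Lambda \<union> {0}\<close>, the substitution \<open>w = R x\<close> turns
  \<open>cesaro t x - \<mu> x = y\<close> into a two-term recursion for \<open>w\<close>. Its factors exceed \<open>t\<close> by a relative error
  of order \<open>1 / n\<close>, so their products are at most \<open>t ^ m\<close> times a polynomial in \<open>m\<close>, and a high power
  of \<open>R\<close> applied to \<open>\<bar>y\<bar>\<close> dominates the solution (\<open>cesaro_solution\<close>). Solidness puts the solution into \<open>X\<close>,
  and the boundedness principle makes the inverse continuous.

  At \<open>\<mu> = 0\<close> the operator is injective, and its range contains all unit sequences and is therefore dense.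
  It is not all of \<open>X\<close>, for then \<open>D\<close> would have a bounded inverse although \<open>D e\<^sub>n = e\<^sub>n / (n + 1)\<close>.
\<close>

section \<open>Order bounded operators on a solid Banach lattice\<close>

lemma sum_seq_apply: "(\<Sum>k\<in>A. f k) n = (\<Sum>k\<in>A. f k n :: complex)"
  by (induction A rule: infinite_finite_induct) auto

lemma coordinatewise_convergent_subsequence:
  fixes f :: "nat \<Rightarrow> cseq"
  assumes "\<And>j n. cmod (f j n) \<le> B n"
  obtains r l where "strict_mono r" "\<And>n. (\<lambda>j. f (r j) n) \<longlonglongrightarrow> l n"
proof -
  let ?K = "PiE UNIV (\<lambda>n. cball (0::complex) (B n))"
  have "compactin (product_topology (\<lambda>_. euclidean) UNIV) ?K"
    by (simp add: compactin_PiE)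
  then have "compact ?K"
    by (simp add: euclidean_product_topology)
  then have "seq_compact ?K"
    by (rule compact_imp_seq_compact)
  moreover have "\<forall>j. f j \<in> ?K"
    using assms by (auto simp: PiE_def)
  ultimately obtain l r where r: "strict_mono (r :: nat \<Rightarrow> nat)" and l: "(f \<circ> r) \<longlonglongrightarrow> l"
    by (blast elim: seq_compactE)
  have "(\<lambda>j. f (r j) n) \<longlonglongrightarrow> l n" for n
  proof -
    have "continuous_on UNIV (\<lambda>x :: cseq. x n)"
      by (rule continuous_on_product_coordinates)
    then have "isCont (\<lambda>x :: cseq. x n) l"
      by (metis continuous_on_eq_continuous_at open_UNIV UNIV_I)
    then show ?thesis
      using isCont_tendsto_compose[OF _ l, of "\<lambda>x. x n"] by (simp add: o_def)
  qed
  with r show ?thesis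
    using that by blast
qed

context solid_banach_lattice
begin

lemma zero_in_X: "0 \<in> X"
  and add_in_X: "x \<in> X \<Longrightarrow> y \<in> X \<Longrightarrow> x + y \<in> X"
  and diff_in_X: "x \<in> X \<Longrightarrow> y \<in> X \<Longrightarrow> x - y \<in> X"
  and scale_in_X: "x \<in> X \<Longrightarrow> cscale c x \<in> X"
  and sum_in_X: "(\<And>k. k \<in> A \<Longrightarrow> f k \<in> X) \<Longrightarrow> sum f A \<in> X"
  using subspace_X
  by (auto intro: cseq.subspace_0 cseq.subspace_add cseq.subspace_diff cseq.subspace_scale
      cseq.subspace_sum)

lemma N_zero: "N 0 = 0"
  using N_eq_0 zero_in_X by blast

lemma N_uminus: "x \<in> X \<Longrightarrow> N (- x) = N x"
  using N_scale[of x "-1"] by (simp add: cscale_def fun_Compl_def)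

lemma N_diff_le: "x \<in> X \<Longrightarrow> y \<in> X \<Longrightarrow> N (x - y) \<le> N x + N y"
proof -
  assume x: "x \<in> X" and y: "y \<in> X"
  have "x - y = x + cscale (-1) y"
    by (simp add: cscale_def fun_eq_iff)
  then show ?thesis
    using N_triangle[OF x scale_in_X[OF y, of "-1"]] N_scale[OF y, of "-1"] by simp
qed

lemma N_sum_le:
  assumes "\<And>k. k \<in> A \<Longrightarrow> f k \<in> X"
  shows "N (sum f A) \<le> (\<Sum>k\<in>A. N (f k))"
  using assms
proof (induction A rule: infinite_finite_induct)
  case (insert a A)
  have "N (f a + sum f A) \<le> N (f a) + N (sum f A)"
    using insert.prems by (intro N_triangle sum_in_X) auto
  moreover have "N (sum f A) \<le> (\<Sum>k\<in>A. N (f k))"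
    using insert by auto
  ultimately show ?case
    unfolding sum.insert[OF insert.hyps] by linarith
qed (auto simp: N_zero)

lemma unit_seq_in_X: "unit_seq n \<in> X"
  using c00_subset cseq.span_base[of "unit_seq n" "range unit_seq"] by auto

lemma N_unit_seq_pos: "0 < N (unit_seq n)"
proof -
  have "unit_seq n \<noteq> 0"
    by (auto simp: unit_seq_def fun_eq_iff)
  then show ?thesis
    using N_nonneg N_eq_0 unit_seq_in_X by (metis less_eq_real_def)
qed

lemma abs_seq_in_X: "x \<in> X \<Longrightarrow> (\<lambda>n. of_real (cmod (x n))) \<in> X"
  by (rule solid[of x]) auto

lemma N_abs_seq: "x \<in> X \<Longrightarrow> N (\<lambda>n. of_real (cmod (x n))) = N x"
  by (intro antisym N_mono) (auto simp: abs_seq_in_X)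

text \<open>The multiple \<open>x n\<close> of the \<open>n\<close>th unit vector is dominated by \<open>x\<close>.\<close>

lemma coordinate_le_N: "x \<in> X \<Longrightarrow> cmod (x n) \<le> N x / N (unit_seq n)"
proof -
  assume x: "x \<in> X"
  have "N (cscale (x n) (unit_seq n)) \<le> N x"
    using x by (intro N_mono scale_in_X unit_seq_in_X) (auto simp: cscale_def unit_seq_def)
  then show ?thesis
    by (simp add: N_scale unit_seq_in_X N_unit_seq_pos field_simps)
qed

lemma limitin_coordinate:
  assumes "limitin mtopology f l F"
  shows "((\<lambda>k. f k n) \<longlongrightarrow> l n) F"
proof -
  have "continuous_map mtopology euclidean (\<lambda>x. x n)"
    using continuous_map_product_then_coordinatewise(1)[OF continuous_inclusion, of n] by simp
  from continuous_map_limit[OF this assms] show ?thesis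
    by (simp add: o_def)
qed

text \<open>The sum of the moduli of an absolutely convergent series dominates all of its terms.\<close>

lemma summable_norms_dominated:
  assumes u: "\<And>k. u k \<in> X" and summ: "summable (\<lambda>k. N (u k))"
  obtains s where "s \<in> X" "\<And>k n. cmod (u k n) \<le> cmod (s n)"
proof -
  define v where "v k = (\<lambda>n. of_real (cmod (u k n)) :: complex)" for k
  define P where "P m = (\<Sum>k<m. v k)" for m
  have v: "v k \<in> X" "N (v k) = N (u k)" for k
    using u abs_seq_in_X N_abs_seq by (auto simp: v_def)
  have P: "P m \<in> X" for m
    unfolding P_def using v by (intro sum_in_X)
  have "MCauchy P"
    unfolding MCauchy_def
  proof (intro conjI allI impI)
    fix e :: real
    assume "0 < e"
    then obtain M where M: "\<And>m n. m \<ge> M \<Longrightarrow> norm (\<Sum>k\<in>{m..<n}. N (u k)) < e"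
      using summ unfolding summable_Cauchy by blast
    have ordered: "ndist (P n) (P m) < e" if "M \<le> m" "m \<le> n" for m n
    proof -
      have "P n - P m = (\<Sum>k\<in>{m..<n}. v k)"
        using sum_diff_nat_ivl[of 0 m n v] that by (simp add: P_def atLeast0LessThan)
      then have "ndist (P n) (P m) \<le> (\<Sum>k\<in>{m..<n}. N (u k))"
        using N_sum_le[of "{m..<n}" v] v P by (simp add: ndist_def)
      with M[OF that(1), of n] show ?thesis
        by simp
    qed
    have "ndist (P m) (P n) < e" if "M \<le> m" "M \<le> n" for m n
      using ordered[of m n] ordered[of n m] that commute[of "P m" "P n"] by (cases "m \<le> n") auto
    then show "\<exists>M. \<forall>m n. M \<le> m \<longrightarrow> M \<le> n \<longrightarrow> ndist (P m) (P n) < e"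
      by blast
  qed (use P in auto)
  then obtain s where s: "limitin mtopology P s sequentially"
    using complete unfolding mcomplete_def by blast
  then have "s \<in> X"
    by (simp add: limitin_metric)
  moreover have "cmod (u k n) \<le> cmod (s n)" for k n
  proof -
    have "(\<lambda>m. cmod (P m n)) \<longlonglongrightarrow> cmod (s n)"
      by (intro tendsto_norm limitin_coordinate[OF s])
    moreover have "cmod (u k n) \<le> cmod (P m n)" if "m \<ge> Suc k" for m
    proof -
      have "P m n = of_real (\<Sum>i<m. cmod (u i n))"
        by (simp add: P_def v_def sum_seq_apply)
      then have "cmod (P m n) = (\<Sum>i<m. cmod (u i n))"
        by (simp add: sum_nonneg del: of_real_sum)
      with that member_le_sum[of k "{..<m}" "\<lambda>i. cmod (u i n)"] show ?thesis
        by auto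
    qed
    ultimately show ?thesis
      by (blast intro: LIMSEQ_le_const)
  qed
  ultimately show ?thesis
    using that by blast
qed

definition order_bounded_op :: "(cseq \<Rightarrow> cseq) \<Rightarrow> bool" where
  "order_bounded_op T \<longleftrightarrow>
     (\<forall>y\<in>X. \<exists>g\<in>X. \<forall>x\<in>X. (\<forall>n. cmod (x n) \<le> cmod (y n)) \<longrightarrow> (\<forall>n. cmod (T x n) \<le> cmod (g n)))"

text \<open>
  If \<open>T\<close> were unbounded, there would be vectors with summable norms whose images have unbounded norms.
  But vectors with summable norms lie below a single element of \<open>X\<close>, so their images do as well.
\<close>

lemma order_bounded_imp_norm_bounded:
  assumes maps: "\<And>x. x \<in> X \<Longrightarrow> T x \<in> X"
    and scale: "\<And>c x. x \<in> X \<Longrightarrow> T (cscale c x) = cscale c (T x)"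
    and ob: "order_bounded_op T"
  obtains C where "C > 0" "\<And>x. x \<in> X \<Longrightarrow> N (T x) \<le> C * N x"
proof (rule ccontr)
  assume "\<not> thesis"
  then have "\<exists>x\<in>X. N (T x) > 4 ^ k * N x" for k :: nat
    using that[of "4 ^ k"] by (fastforce simp: not_le)
  then obtain x where x: "\<And>k. x k \<in> X" and large: "\<And>k :: nat. N (T (x k)) > 4 ^ k * N (x k)"
    by metis
  have pos: "N (x k) > 0" for k
  proof (rule ccontr)
    assume "\<not> N (x k) > 0"
    then have "N (x k) = 0"
      using N_nonneg[OF x[of k]] by simp
    then have "x k = cscale 0 (x k)"
      using N_eq_0 x by (simp add: cscale_def fun_eq_iff)
    then have "T (x k) = cscale 0 (T (x k))"
      using scale[OF x] by metis
    then have "N (T (x k)) = 0"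
      using N_scale[OF maps[OF x], of 0 k] by simp
    with large[of k] \<open>N (x k) = 0\<close> show False
      by simp
  qed
  \<comment> \<open>After this scaling the norms are summable, while the norms of the images still exceed \<open>2 ^ k\<close>.\<close>
  define z where "z k = cscale (of_real (1 / (2 ^ k * N (x k)))) (x k)" for k
  have z: "z k \<in> X" "N (z k) = (1 / 2) ^ k" "N (T (z k)) > 2 ^ k" for k
  proof -
    show "z k \<in> X"
      by (simp add: z_def scale_in_X x)
    have "N (z k) = 1 / (2 ^ k * N (x k)) * N (x k)"
      unfolding z_def by (subst N_scale[OF x]) (use pos[of k] in \<open>simp add: norm_divide norm_mult norm_power\<close>)
    then show "N (z k) = (1 / 2) ^ k"
      using pos[of k] by (simp add: field_simps)
    have "N (T (z k)) = 1 / (2 ^ k * N (x k)) * N (T (x k))"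
      unfolding z_def scale[OF x]
      by (subst N_scale[OF maps[OF x]]) (use pos[of k] in \<open>simp add: norm_divide norm_mult norm_power\<close>)
    moreover have "2 ^ k * (2 ^ k * N (x k)) < N (T (x k))"
      using large[of k] by (simp add: power_mult_distrib[symmetric] mult.assoc[symmetric])
    ultimately have "2 ^ k * N (x k) * 2 ^ k < 2 ^ k * N (x k) * N (T (z k))"
      using pos[of k] by (simp add: mult_ac)
    then show "N (T (z k)) > 2 ^ k"
      using pos[of k] mult_less_cancel_left_pos[of "2 ^ k * N (x k)"] by simp
  qed
  obtain s where s: "s \<in> X" "\<And>k n. cmod (z k n) \<le> cmod (s n)"
    using summable_norms_dominated[of z] z(1,2) by (auto simp: summable_geometric)
  then obtain g where g: "g \<in> X" "\<And>k n. cmod (T (z k) n) \<le> cmod (g n)"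
    using ob z(1) unfolding order_bounded_op_def by metis
  obtain k where "N g < 2 ^ k"
    using real_arch_pow[of 2 "N g"] by auto
  moreover have "N (T (z k)) \<le> N g"
    by (intro N_mono maps z g)
  ultimately show False
    using z(3)[of k] by simp
qed

lemma bounded_imp_cont_lin_op:
  assumes maps: "\<And>x. x \<in> X \<Longrightarrow> T x \<in> X"
    and add: "\<And>x y. x \<in> X \<Longrightarrow> y \<in> X \<Longrightarrow> T (x + y) = T x + T y"
    and scale: "\<And>c x. x \<in> X \<Longrightarrow> T (cscale c x) = cscale c (T x)"
    and bound: "C > 0" "\<And>x. x \<in> X \<Longrightarrow> N (T x) \<le> C * N x"
  shows "cont_lin_op T"
proof -
  have diff: "T (x - y) = T x - T y" if "x \<in> X" "y \<in> X" for x y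
    using add[of "x - y" y] that diff_in_X by simp
  have "continuous_map mtopology mtopology T"
    unfolding metric_continuous_map[OF Metric_space_axioms]
  proof (intro conjI ballI allI impI)
    fix a and e :: real
    assume a: "a \<in> X" and e: "0 < e"
    have "ndist (T a) (T x) < e" if "x \<in> X" "ndist a x < e / C" for x
    proof -
      have "ndist (T a) (T x) \<le> C * ndist a x"
        using a that bound(2)[of "a - x"] maps diff_in_X by (simp add: ndist_def diff)
      also have "\<dots> < e"
        using that bound(1) by (simp add: field_simps)
      finally show ?thesis .
    qed
    then show "\<exists>\<delta>>0. \<forall>x. x \<in> X \<and> ndist a x < \<delta> \<longrightarrow> ndist (T a) (T x) < e"
      using e bound(1) by (intro exI[of _ "e / C"]) auto
  qed (use maps in auto)
  with maps add scale show ?thesis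
    unfolding cont_lin_op_def by auto
qed

lemma order_bounded_imp_cont_lin_op:
  assumes "\<And>x. x \<in> X \<Longrightarrow> T x \<in> X"
    and "\<And>x y. x \<in> X \<Longrightarrow> y \<in> X \<Longrightarrow> T (x + y) = T x + T y"
    and "\<And>c x. x \<in> X \<Longrightarrow> T (cscale c x) = cscale c (T x)"
    and "order_bounded_op T"
  shows "cont_lin_op T"
  using order_bounded_imp_norm_bounded[of T] bounded_imp_cont_lin_op[of T] assms by metis

text \<open>
  Images of the unit ball are bounded in each coordinate, so a sequence of them has a coordinatewise
  convergent subsequence. This is Cauchy in \<open>X\<close>: finitely many coordinates are harmless, and the
  remaining ones are multiplied by small factors.
\<close>

lemma null_multiplier_compact:
  assumes maps: "\<And>x. x \<in> X \<Longrightarrow> A x \<in> X"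
    and bound: "C > 0" "\<And>x. x \<in> X \<Longrightarrow> N (A x) \<le> C * N x"
    and d: "d \<longlonglongrightarrow> 0"
    and cont: "cont_lin_op (\<lambda>x n. d n * A x n)"
  shows "compact_op (\<lambda>x n. d n * A x n)"
proof -
  let ?T = "\<lambda>x n. d n * A x n"
  let ?B = "mcball 0 1"
  have T: "?T x \<in> X" if "x \<in> X" for x
    using cont that unfolding cont_lin_op_def by auto
  have ball: "x \<in> X" "N (A x) \<le> C" if "x \<in> ?B" for x
  proof -
    show x: "x \<in> X"
      using that by simp
    have "N x \<le> 1"
      using that x commute[of 0 x] by (simp add: ndist_def zero_in_X fun_diff_def)
    then show "N (A x) \<le> C"
      using bound(2)[OF x] bound(1) mult_left_mono[of "N x" 1 C] by linarith
  qed
  have "mtotally_bounded (?T ` ?B)"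
    unfolding mtotally_bounded_sequentially
  proof (intro conjI allI impI)
    show "?T ` ?B \<subseteq> X"
      by (intro image_subsetI T ball(1))
    fix \<sigma> :: "nat \<Rightarrow> cseq"
    assume "range \<sigma> \<subseteq> ?T ` ?B"
    then have "\<forall>j. \<exists>x\<in>?B. \<sigma> j = ?T x"
      by blast
    then obtain x where x: "\<And>j. x j \<in> ?B" and \<sigma>: "\<And>j. \<sigma> j = ?T (x j)"
      by metis
    note xX = ball(1)[OF x] and xA = ball(2)[OF x]
    have \<sigma>X: "\<sigma> j \<in> X" for j
      using T xX by (simp add: \<sigma>)
    have "cmod (\<sigma> j n) \<le> cmod (d n) * (C / N (unit_seq n))" for j n
    proof -
      have "cmod (A (x j) n) \<le> N (A (x j)) / N (unit_seq n)"
        by (intro coordinate_le_N maps xX)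
      also have "\<dots> \<le> C / N (unit_seq n)"
        using xA N_unit_seq_pos[of n] by (intro divide_right_mono) auto
      finally show ?thesis
        unfolding \<sigma> norm_mult by (intro mult_left_mono) auto
    qed
    then obtain r l where r: "strict_mono (r :: nat \<Rightarrow> nat)"
      and l: "\<And>n. (\<lambda>j. \<sigma> (r j) n) \<longlonglongrightarrow> l n"
      using coordinatewise_convergent_subsequence[of \<sigma> "\<lambda>n. cmod (d n) * (C / N (unit_seq n))"]
      by blast
    have "MCauchy (\<sigma> \<circ> r)"
      unfolding MCauchy_def
    proof (intro conjI allI impI)
      fix e :: real
      assume e: "0 < e"
      then obtain M where M: "\<And>n. n \<ge> M \<Longrightarrow> cmod (d n) < e / (4 * C)"
        using LIMSEQ_D[OF d, of "e / (4 * C)"] bound(1) by auto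
      have "(\<lambda>j. \<Sum>k<M. cmod (\<sigma> (r j) k - l k) * N (unit_seq k))
          \<longlonglongrightarrow> (\<Sum>k<M. cmod (l k - l k) * N (unit_seq k))"
        by (intro tendsto_intros l)
      then have "(\<lambda>j. \<Sum>k<M. cmod (\<sigma> (r j) k - l k) * N (unit_seq k)) \<longlonglongrightarrow> 0"
        by simp
      then obtain J where J: "\<And>j. j \<ge> J \<Longrightarrow> (\<Sum>k<M. cmod (\<sigma> (r j) k - l k) * N (unit_seq k)) < e / 4"
        using LIMSEQ_D[of _ 0 "e / 4"] e by (fastforce simp: abs_less_iff)
      have "ndist (\<sigma> (r i)) (\<sigma> (r j)) < e" if "J \<le> i" "J \<le> j" for i j
      proof -
        let ?y = "\<sigma> (r i) - \<sigma> (r j)"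
        let ?a = "A (x (r i)) - A (x (r j))"
        define head where "head = (\<Sum>k<M. cscale (?y k) (unit_seq k))"
        define tail where "tail = (\<lambda>n. if n < M then 0 else ?y n)"
        have head_in: "head \<in> X"
          unfolding head_def by (intro sum_in_X scale_in_X unit_seq_in_X)
        have a_in: "?a \<in> X"
          by (intro diff_in_X maps xX)
        \<comment> \<open>Both vectors \<open>A (x (r i))\<close> and \<open>A (x (r j))\<close> have norm at most \<open>C\<close>, hence the constant \<open>4 * C\<close>.\<close>
        have tail_le: "cmod (tail n) \<le> cmod (cscale (of_real (e / (4 * C))) ?a n)" for n
        proof (cases "n < M")
          case False
          then have "tail n = d n * ?a n"
            by (simp add: tail_def \<sigma> right_diff_distrib)
          then have "cmod (tail n) \<le> e / (4 * C) * cmod (?a n)"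
            unfolding norm_mult using M[of n] False by (simp only: norm_mult) (intro mult_right_mono, auto)
          also have "e / (4 * C) = cmod (of_real (e / (4 * C)))"
            using e bound(1) by (simp only: norm_of_real) simp
          finally show ?thesis
            by (simp only: cscale_def norm_mult)
        qed (simp add: tail_def)
        have tail_in: "tail \<in> X"
          by (rule solid[OF scale_in_X[OF a_in] tail_le])
        have "?y = head + tail"
        proof
          fix n
          have "head n = (\<Sum>k<M. if k = n then ?y k else 0)"
            unfolding head_def sum_seq_apply by (intro sum.cong) (auto simp: cscale_def unit_seq_def)
          then show "?y n = (head + tail) n"
            by (simp add: tail_def)
        qed
        then have "ndist (\<sigma> (r i)) (\<sigma> (r j)) \<le> N head + N tail"
          using N_triangle[OF head_in tail_in] \<sigma>X by (simp add: ndist_def)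
        moreover have "N tail \<le> e / 2"
        proof -
          have "N tail \<le> cmod (of_real (e / (4 * C))) * N ?a"
            using N_mono[OF tail_in scale_in_X[OF a_in] tail_le] N_scale[OF a_in] by metis
          also have "\<dots> = e / (4 * C) * N ?a"
            using e bound(1) by (simp add: norm_divide norm_mult)
          also have "\<dots> \<le> e / (4 * C) * (2 * C)"
            using N_diff_le[OF maps maps, of "x (r i)" "x (r j)"] xX xA[of "r i"] xA[of "r j"] e bound(1)
            by (intro mult_left_mono) auto
          finally show ?thesis
            using bound(1) by simp
        qed
        moreover have "N head < e / 2"
        proof -
          have "N head \<le> (\<Sum>k<M. cmod (?y k) * N (unit_seq k))"
            unfolding head_def
            using N_sum_le[of "{..<M}" "\<lambda>k. cscale (?y k) (unit_seq k)"]
            by (simp add: scale_in_X unit_seq_in_X N_scale)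
          also have "\<dots> \<le> (\<Sum>k<M. cmod (\<sigma> (r i) k - l k) * N (unit_seq k)
              + cmod (\<sigma> (r j) k - l k) * N (unit_seq k))"
          proof (intro sum_mono)
            fix k
            have "cmod (?y k) \<le> cmod (\<sigma> (r i) k - l k) + cmod (\<sigma> (r j) k - l k)"
              using norm_triangle_ineq4[of "\<sigma> (r i) k - l k" "\<sigma> (r j) k - l k"] by simp
            then show "cmod (?y k) * N (unit_seq k) \<le> cmod (\<sigma> (r i) k - l k) * N (unit_seq k)
              + cmod (\<sigma> (r j) k - l k) * N (unit_seq k)"
              using N_unit_seq_pos[of k] by (simp flip: distrib_right)
          qed
          also have "\<dots> < e / 2"
            using J[OF that(1)] J[OF that(2)] by (simp add: sum.distrib)
          finally show ?thesis .
        qed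
        ultimately show ?thesis
          by simp
      qed
      then show "\<exists>J. \<forall>i j. J \<le> i \<longrightarrow> J \<le> j \<longrightarrow> ndist ((\<sigma> \<circ> r) i) ((\<sigma> \<circ> r) j) < e"
        by auto
    qed (use \<sigma>X in auto)
    with r show "\<exists>r. strict_mono r \<and> MCauchy (\<sigma> \<circ> r)"
      by blast
  qed
  then have "compactin mtopology (mtopology closure_of (?T ` ?B))"
    using mtotally_bounded_eq_compact_closure_of[OF complete] by blast
  with cont show ?thesis
    unfolding compact_op_def by blast
qed

end

section \<open>Powers of the resolvent of the shift\<close>

text \<open>
  This is \<open>R\<^sup>p\<^sup>+\<^sup>1\<close> for the inverse \<open>R\<close> of \<open>I - t S\<close>, where \<open>S\<close> is the right shift: the matrix entries are the
  Taylor coefficients of \<open>1 / (1 - t z) ^ (p + 1)\<close>. The exponent is shifted by one so that the binomial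
  coefficients need no truncated subtraction and \<open>p = 0\<close> gives \<open>R\<close>.
\<close>

definition resolvent_power :: "real \<Rightarrow> nat \<Rightarrow> cseq \<Rightarrow> cseq" where
  "resolvent_power t p x =
     (\<lambda>n. \<Sum>k\<le>n. of_nat ((n - k + p) choose p) * of_real t ^ (n - k) * x k)"

lemma resolvent_power_at_0 [simp]: "resolvent_power t p x 0 = x 0"
  by (simp add: resolvent_power_def)

lemma resolvent_power_0_Suc:
  "resolvent_power t 0 x (Suc n) = of_real t * resolvent_power t 0 x n + x (Suc n)"
  by (simp add: resolvent_power_def sum_distrib_left Suc_diff_le mult.assoc)

text \<open>Pascal's rule for the entries, that is, \<open>(I - t S) R\<^sup>p\<^sup>+\<^sup>2 = R\<^sup>p\<^sup>+\<^sup>1\<close>.\<close>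

lemma resolvent_power_Suc_Suc:
  "resolvent_power t (Suc p) x (Suc n) =
     of_real t * resolvent_power t (Suc p) x n + resolvent_power t p x (Suc n)"
  by (simp add: resolvent_power_def sum_distrib_left Suc_diff_le sum.distrib[symmetric]
      algebra_simps)

text \<open>The hypotheses say \<open>(I - t S) w = x\<close>.\<close>

lemma resolvent_0_unique:
  assumes "w 0 = x 0" "\<And>n. w (Suc n) = of_real t * w n + x (Suc n)"
  shows "w = resolvent_power t 0 x"
proof
  show "w n = resolvent_power t 0 x n" for n
    by (induction n) (simp_all add: assms resolvent_power_0_Suc)
qed

lemma resolvent_power_Suc:
  "resolvent_power t (Suc p) x = resolvent_power t 0 (resolvent_power t p x)"
  by (rule resolvent_0_unique) (simp_all add: resolvent_power_Suc_Suc)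

lemma cesaro_eq_resolvent: "cesaro t x n = 1 / of_nat (n + 1) * resolvent_power t 0 x n"
  by (simp add: cesaro_def resolvent_power_def)

lemma resolvent_power_add: "resolvent_power t p (x + y) = resolvent_power t p x + resolvent_power t p y"
  by (simp add: resolvent_power_def fun_eq_iff sum.distrib algebra_simps)

lemma resolvent_power_scale: "resolvent_power t p (cscale c x) = cscale c (resolvent_power t p x)"
  by (simp add: resolvent_power_def cscale_def fun_eq_iff sum_distrib_left algebra_simps)

lemma cesaro_add: "cesaro t (x + y) = cesaro t x + cesaro t y"
  by (simp add: cesaro_eq_resolvent fun_eq_iff resolvent_power_add algebra_simps)

lemma cesaro_scale: "cesaro t (cscale c x) = cscale c (cesaro t x)"
  by (simp add: cesaro_eq_resolvent fun_eq_iff resolvent_power_scale)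
    (simp add: cscale_def cesaro_eq_resolvent)

lemma cmod_resolvent_power_real:
  assumes "0 \<le> t" "\<And>k. 0 \<le> a k"
  shows "cmod (resolvent_power t p (\<lambda>k. of_real (a k)) n) =
    (\<Sum>k\<le>n. real ((n - k + p) choose p) * t ^ (n - k) * a k)"
proof -
  have "resolvent_power t p (\<lambda>k. of_real (a k)) n =
      of_real (\<Sum>k\<le>n. real ((n - k + p) choose p) * t ^ (n - k) * a k)"
    by (simp add: resolvent_power_def)
  then show ?thesis
    using assms by (simp add: sum_nonneg del: of_real_sum of_real_mult)
qed

lemma cmod_resolvent_power_mono:
  assumes "0 \<le> t" "\<And>k. cmod (x k) \<le> a k"
  shows "cmod (resolvent_power t p x n) \<le> cmod (resolvent_power t p (\<lambda>k. of_real (a k)) n)"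
proof -
  have nonneg: "0 \<le> a k" for k
    using assms(2)[of k] norm_ge_zero order_trans by blast
  have "cmod (resolvent_power t p x n) \<le>
      (\<Sum>k\<le>n. cmod (of_nat ((n - k + p) choose p) * of_real t ^ (n - k) * x k))"
    unfolding resolvent_power_def by (rule norm_sum)
  also have "\<dots> \<le> (\<Sum>k\<le>n. real ((n - k + p) choose p) * t ^ (n - k) * a k)"
    using assms by (intro sum_mono) (auto simp: norm_mult norm_power intro!: mult_left_mono)
  finally show ?thesis
    by (simp add: cmod_resolvent_power_real assms(1) nonneg)
qed

text \<open>
  Iterating the recursion multiplies \<open>a k\<close> by \<open>t ^ (n - k)\<close> and by the product of the factors
  \<open>1 + c / (j + 1)\<close> with \<open>k < j \<le> n\<close>. Since these factors are at most \<open>1 + p / (j - k)\<close>, this product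
  is at most \<open>(n - k + p) choose p\<close>.
\<close>

lemma recursion_bound:
  fixes a b :: "nat \<Rightarrow> real"
  assumes t: "0 \<le> t" and a: "\<And>k. 0 \<le> a k" and c: "0 \<le> c" "c \<le> real p"
    and b0: "b 0 \<le> a 0"
    and b_Suc: "\<And>n. b (Suc n) \<le> t * (1 + c / real (n + 2)) * b n + a (Suc n)"
  shows "b n \<le> (\<Sum>k\<le>n. real ((n - k + p) choose p) * t ^ (n - k) * a k)"
proof (induction n)
  case 0
  then show ?case
    using b0 by simp
next
  case (Suc n)
  let ?S = "\<lambda>n. \<Sum>k\<le>n. real ((n - k + p) choose p) * t ^ (n - k) * a k"
  have binom: "(1 + c / real (n + 2)) * real ((m + p) choose p) \<le> real ((Suc m + p) choose p)"
    if "m \<le> n" for m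
  proof -
    have "(Suc m + p - p) * ((Suc m + p) choose p) = (Suc m + p) * ((Suc m + p - 1) choose p)"
      by (rule binomial_absorb_comp)
    then have "real (Suc m * ((Suc m + p) choose p)) = real ((Suc m + p) * ((m + p) choose p))"
      by simp
    then have "real ((Suc m + p) choose p) = (1 + p / real (Suc m)) * real ((m + p) choose p)"
      by (simp add: field_simps)
    moreover have "c / real (n + 2) \<le> p / real (Suc m)"
      using c that by (intro frac_le) auto
    ultimately show ?thesis
      by (simp add: mult_right_mono)
  qed
  have "b (Suc n) \<le> t * (1 + c / real (n + 2)) * b n + a (Suc n)"
    by (rule b_Suc)
  also have "\<dots> \<le> t * (1 + c / real (n + 2)) * ?S n + a (Suc n)"
    using Suc.IH t c by (intro add_right_mono mult_left_mono) auto
  also have "t * (1 + c / real (n + 2)) * ?S n =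
      (\<Sum>k\<le>n. ((1 + c / real (n + 2)) * real ((n - k + p) choose p)) * (t ^ Suc (n - k) * a k))"
    by (simp add: sum_distrib_left algebra_simps)
  also have "\<dots> \<le> (\<Sum>k\<le>n. real ((Suc (n - k) + p) choose p) * (t ^ Suc (n - k) * a k))"
    using t a by (intro sum_mono mult_right_mono binom) auto
  also have "\<dots> + a (Suc n) = ?S (Suc n)"
    by (simp add: Suc_diff_le mult.assoc)
  finally show ?case
    by simp
qed

section \<open>Eigenvectors and the inhomogeneous equation for all sequences\<close>

lemma zero_notin_Lambda: "0 \<notin> Lambda"
proof
  assume "0 \<in> Lambda"
  then obtain n where "(0 :: complex) = 1 / of_nat (Suc n)"
    by (auto simp: Lambda_def)
  then show False
    by (simp del: of_nat_Suc)
qed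

lemma in_Lambda: "1 / of_nat (n + 1) \<in> Lambda"
  by (auto simp: Lambda_def)

lemma cesaro_first_nonzero:
  assumes "\<And>k. k < n \<Longrightarrow> x k = 0"
  shows "cesaro t x n = 1 / of_nat (n + 1) * x n"
proof -
  have "(\<Sum>k\<le>n. of_real t ^ (n - k) * x k) = (\<Sum>k\<in>{n}. of_real t ^ (n - k) * x k)"
    using assms by (intro sum.mono_neutral_right) auto
  then show ?thesis
    by (simp add: cesaro_def)
qed

text \<open>Compare both sides at the first nonzero coordinate of \<open>x\<close>.\<close>

lemma cesaro_eigenvalue_in_Lambda:
  assumes "cesaro t x = cscale \<mu> x" "x \<noteq> 0"
  shows "\<mu> \<in> Lambda"
proof -
  define n where "n = (LEAST n. x n \<noteq> 0)"
  have "\<exists>n. x n \<noteq> 0"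
    using assms(2) by (auto simp: fun_eq_iff)
  then have n: "x n \<noteq> 0" "\<And>k. k < n \<Longrightarrow> x k = 0"
    unfolding n_def using LeastI_ex[of "\<lambda>n. x n \<noteq> 0"] not_less_Least by blast+
  have "1 / of_nat (n + 1) * x n = \<mu> * x n"
    using cesaro_first_nonzero[of n x t] n(2) assms(1) by (simp add: cscale_def)
  then have "\<mu> = 1 / of_nat (n + 1)"
    using n(1) by (metis mult_right_cancel)
  then show ?thesis
    using in_Lambda by simp
qed

lemma resolvent_power_unit_seq:
  "resolvent_power t p (unit_seq n) m =
     (if n \<le> m then of_nat ((m - n + p) choose p) * of_real t ^ (m - n) else 0)"
proof -
  have "resolvent_power t p (unit_seq n) m =
      (\<Sum>k\<le>m. if k = n then of_nat ((m - k + p) choose p) * of_real t ^ (m - k) else 0)"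
    unfolding resolvent_power_def unit_seq_def by (intro sum.cong) auto
  then show ?thesis
    by simp
qed

text \<open>
  For \<open>\<mu> = 1 / (n + 1)\<close> and an eigenvector \<open>x\<close>, the sequence \<open>w = R x\<close> satisfies
  \<open>w k = t * (k + 1) / (k - n) * w (k - 1)\<close> for \<open>k > n\<close>. The products of these factors are binomial
  coefficients times powers of \<open>t\<close>, which leads to \<open>w = R\<^sup>n\<^sup>+\<^sup>2 e\<^sub>n\<close>. The eigenvalue equation then amounts to
  the absorption identity for binomial coefficients.
\<close>

lemma cesaro_eigenvector:
  "cesaro t (resolvent_power t n (unit_seq n)) =
     cscale (1 / of_nat (n + 1)) (resolvent_power t n (unit_seq n))"
proof
  fix m
  have "cesaro t (resolvent_power t n (unit_seq n)) m =
      1 / of_nat (m + 1) * resolvent_power t (Suc n) (unit_seq n) m"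
    by (simp add: cesaro_eq_resolvent resolvent_power_Suc)
  also have "\<dots> = 1 / of_nat (n + 1) * resolvent_power t n (unit_seq n) m"
  proof (cases "n \<le> m")
    case True
    have "Suc n * (Suc m choose Suc n) = Suc m * (m choose n)"
      using Suc_times_binomial_eq[of m n] by (simp only: mult.commute)
    then have "(of_nat (Suc n) * of_nat (Suc m choose Suc n) :: complex) = of_nat (Suc m) * of_nat (m choose n)"
      by (simp only: of_nat_mult[symmetric])
    then have "of_nat (Suc m choose Suc n) / of_nat (m + 1) = (of_nat (m choose n) / of_nat (n + 1) :: complex)"
      by (simp add: frac_eq_eq mult.commute del: of_nat_Suc binomial_Suc_Suc)
    then have "1 / of_nat (m + 1) * (of_nat (Suc m choose Suc n) * z) =
        1 / of_nat (n + 1) * (of_nat (m choose n) * z)" for z :: complex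
      by (metis times_divide_eq_left mult_1_left)
    moreover have "m - n + Suc n = Suc m" "m - n + n = m"
      using True by simp_all
    ultimately show ?thesis
      using True by (simp only: resolvent_power_unit_seq if_True mult.assoc)
  qed (simp add: resolvent_power_unit_seq)
  finally show "cesaro t (resolvent_power t n (unit_seq n)) m =
      cscale (1 / of_nat (n + 1)) (resolvent_power t n (unit_seq n)) m"
    by (simp add: cscale_def)
qed

text \<open>
  With \<open>w = resolvent_power t 0 x\<close> and \<open>d n = 1 / (n + 1)\<close> the equation reads
  \<open>(\<mu> - d n) * w n = \<mu> * t * w (n - 1) - y n\<close>. The numbers \<open>\<mu> - d n\<close> do not vanish and tend to \<open>\<mu> \<noteq> 0\<close>,
  so their inverses are bounded by some \<open>c\<close>. Hence \<open>\<mu> / (\<mu> - d n) = 1 + d n / (\<mu> - d n)\<close> has modulus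
  at most \<open>1 + c / (n + 1)\<close>, which is the recursion treated above. The constants do not depend on \<open>y\<close>.
\<close>

lemma cesaro_solution:
  assumes t: "0 \<le> t" and \<mu>: "\<mu> \<notin> Lambda \<union> {0}"
  obtains C p where "0 < C"
    "\<And>y. \<exists>x. cesaro t x - cscale \<mu> x = y \<and>
      (\<forall>n. cmod (x n) \<le> C * (cmod (resolvent_power t p (\<lambda>k. of_real (cmod (y k))) n) + cmod (y n)))"
proof -
  define d :: "nat \<Rightarrow> complex" where "d n = 1 / of_nat (n + 1)" for n
  have d: "\<mu> - d n \<noteq> 0" for n
    using \<mu> in_Lambda[of n] by (auto simp: d_def)
  have "d = (\<lambda>n. 1 / of_nat (Suc n))"
    by (simp add: d_def fun_eq_iff)
  then have "d \<longlonglongrightarrow> 0"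
    using LIMSEQ_Suc[OF lim_1_over_n[where 'a=complex]] by (simp only:)
  then have "(\<lambda>n. inverse (\<mu> - d n)) \<longlonglongrightarrow> inverse (\<mu> - 0)"
    using \<mu> by (intro tendsto_intros) auto
  then have "Bseq (\<lambda>n. inverse (\<mu> - d n))"
    by (intro convergent_imp_Bseq convergentI)
  then obtain c where c: "0 < c" "\<And>n. cmod (inverse (\<mu> - d n)) \<le> c"
    by (auto elim: BseqE)
  obtain p where p: "c \<le> real p"
    using real_arch_simple by blast
  define C where "C = (c + 1) / cmod \<mu>"
  have C: "C > 0"
    using c \<mu> by (simp add: C_def)
  moreover have "\<exists>x. cesaro t x - cscale \<mu> x = y \<and>
      (\<forall>n. cmod (x n) \<le> C * (cmod (resolvent_power t p (\<lambda>k. of_real (cmod (y k))) n) + cmod (y n)))" for y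
  proof -
    define w where "w = rec_nat (- y 0 / (\<mu> - d 0))
      (\<lambda>n z. (\<mu> * of_real t * z - y (Suc n)) / (\<mu> - d (Suc n)))"
    have w_0: "w 0 = - y 0 / (\<mu> - d 0)"
      and w_Suc: "w (Suc n) = (\<mu> * of_real t * w n - y (Suc n)) / (\<mu> - d (Suc n))" for n
      by (simp_all add: w_def)
    \<comment> \<open>The equation itself, \<open>d n * w n - \<mu> * x n = y n\<close>, solved for \<open>x n\<close>.\<close>
    define x where "x n = (d n * w n - y n) / \<mu>" for n
    have "w = resolvent_power t 0 x"
    proof (rule resolvent_0_unique)
      have "(\<mu> - d 0) * w 0 = - y 0"
        using d by (simp add: w_0)
      then show "w 0 = x 0"
        using \<mu> by (simp add: x_def field_simps)
      show "w (Suc n) = of_real t * w n + x (Suc n)" for n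
      proof -
        have "(\<mu> - d (Suc n)) * w (Suc n) = \<mu> * of_real t * w n - y (Suc n)"
          using d by (simp add: w_Suc)
        then show ?thesis
          using \<mu> by (simp add: x_def field_simps)
      qed
    qed
    then have "cesaro t x - cscale \<mu> x = y"
      using \<mu> by (simp add: fun_eq_iff cesaro_eq_resolvent cscale_def x_def d_def)
    moreover have "cmod (x n) \<le>
        C * (cmod (resolvent_power t p (\<lambda>k. of_real (cmod (y k))) n) + cmod (y n))" for n
    proof -
      let ?W = "\<lambda>n. cmod (resolvent_power t p (\<lambda>k. of_real (cmod (y k))) n)"
      have div_le: "cmod (z / (\<mu> - d n)) \<le> c * cmod z" for z n
        using mult_right_mono[OF c(2)[of n], of "cmod z"]
        by (simp add: divide_inverse norm_mult mult.commute)
      have "cmod (w n) \<le> (\<Sum>k\<le>n. real ((n - k + p) choose p) * t ^ (n - k) * (c * cmod (y k)))"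
      proof (rule recursion_bound[OF t _ _ p])
        show "cmod (w 0) \<le> c * cmod (y 0)"
          using div_le[of "- y 0" 0] by (simp add: w_0)
        fix n
        have "cmod (\<mu> / (\<mu> - d (Suc n))) \<le> 1 + c / real (n + 2)"
        proof -
          have "\<mu> / (\<mu> - d (Suc n)) = 1 + d (Suc n) / (\<mu> - d (Suc n))"
            using d[of "Suc n"] by (simp add: field_simps)
          also have "cmod \<dots> \<le> 1 + c * cmod (d (Suc n))"
            using norm_triangle_ineq[of 1 "d (Suc n) / (\<mu> - d (Suc n))"] div_le[of "d (Suc n)" "Suc n"]
            by simp
          also have "cmod (d (Suc n)) = 1 / real (n + 2)"
            using norm_of_nat[of "n + 2", where 'a=complex] by (simp add: d_def norm_divide del: norm_of_nat)
          finally show ?thesis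
            by simp
        qed
        then have "t * cmod (w n) * cmod (\<mu> / (\<mu> - d (Suc n))) \<le> t * cmod (w n) * (1 + c / real (n + 2))"
          using t by (intro mult_left_mono) auto
        moreover have "w (Suc n) = of_real t * w n * (\<mu> / (\<mu> - d (Suc n))) - y (Suc n) / (\<mu> - d (Suc n))"
          by (simp add: w_Suc diff_divide_distrib mult_ac)
        ultimately show "cmod (w (Suc n)) \<le> t * (1 + c / real (n + 2)) * cmod (w n) + c * cmod (y (Suc n))"
          using norm_triangle_ineq4[of "of_real t * w n * (\<mu> / (\<mu> - d (Suc n)))" "y (Suc n) / (\<mu> - d (Suc n))"]
            div_le[of "y (Suc n)" "Suc n"] t
          by (simp add: norm_mult norm_divide mult_ac)
      qed (use c in auto)
      also have "\<dots> = c * ?W n"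
        using t by (simp add: cmod_resolvent_power_real sum_distrib_left mult_ac)
      finally have "cmod (w n) \<le> c * ?W n" .
      moreover have "cmod (d n) \<le> 1"
        by (simp add: d_def norm_divide flip: of_nat_Suc)
      ultimately have "cmod (d n * w n) \<le> c * ?W n"
        using mult_mono[of "cmod (d n)" 1 "cmod (w n)" "c * ?W n"] by (simp add: norm_mult)
      then have "cmod (d n * w n - y n) \<le> c * ?W n + cmod (y n)"
        using norm_triangle_ineq4[of "d n * w n" "y n"] by linarith
      also have "\<dots> \<le> (c + 1) * (?W n + cmod (y n))"
        using c(1) by (simp add: algebra_simps)
      finally show ?thesis
        by (simp add: x_def C_def norm_divide divide_right_mono)
    qed
    ultimately show ?thesis
      by blast
  qed
  ultimately show ?thesis
    using that by blast
qed

section \<open>Continuity and compactness\<close>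

lemma right_shift_pow: "(right_shift ^^ k) x n = (if k \<le> n then x (n - k) else 0)"
  by (induction k arbitrary: n) (auto simp: right_shift_def split: nat.split)

lemma sum_shifts_eq_resolvent:
  assumes "n < m"
  shows "(\<Sum>k<m. cscale (of_real t ^ k) ((right_shift ^^ k) x)) n = resolvent_power t 0 x n"
proof -
  have "(\<Sum>k<m. cscale (of_real t ^ k) ((right_shift ^^ k) x)) n = (\<Sum>k\<le>n. of_real t ^ k * x (n - k))"
    unfolding sum_seq_apply using assms
    by (intro sum.mono_neutral_cong_right) (auto simp: cscale_def right_shift_pow)
  also have "\<dots> = (\<Sum>k\<le>n. of_real t ^ (n - k) * x k)"
    by (rule sum.reindex_bij_witness[of _ "\<lambda>k. n - k" "\<lambda>k. n - k"]) auto
  finally show ?thesis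
    by (simp add: resolvent_power_def)
qed

context solid_banach_lattice
begin

text \<open>
  Convergence in \<open>X\<close> implies coordinatewise convergence, and each coordinate of the partial sums is
  eventually constant. So the sum of the series in \<open>X\<close> can only be \<open>resolvent_power t 0 x\<close>.
\<close>

lemma resolvent_in_X:
  assumes "series_converges (\<lambda>n. cscale (of_real t ^ n) ((right_shift ^^ n) x))"
  shows "resolvent_power t 0 x \<in> X"
proof -
  obtain s where s: "limitin mtopology (\<lambda>m. \<Sum>n<m. cscale (of_real t ^ n) ((right_shift ^^ n) x)) s sequentially"
    using assms unfolding series_converges_def by blast
  have "s n = resolvent_power t 0 x n" for n
  proof -
    have "eventually (\<lambda>m. (\<Sum>k<m. cscale (of_real t ^ k) ((right_shift ^^ k) x)) n = resolvent_power t 0 x n) sequentially"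
      using eventually_gt_at_top[of n] by eventually_elim (rule sum_shifts_eq_resolvent)
    then have "(\<lambda>m. (\<Sum>k<m. cscale (of_real t ^ k) ((right_shift ^^ k) x)) n) \<longlonglongrightarrow> resolvent_power t 0 x n"
      by (rule tendsto_eventually)
    with limitin_coordinate[OF s, of n] show ?thesis
      by (rule LIMSEQ_unique)
  qed
  then have "s = resolvent_power t 0 x"
    by (rule ext)
  moreover have "s \<in> X"
    using s by (simp add: limitin_metric)
  ultimately show ?thesis
    by simp
qed

lemma resolvent_power_in_X:
  assumes "resolvent_power t 0 ` X \<subseteq> X" "x \<in> X"
  shows "resolvent_power t p x \<in> X"
  using assms by (induction p) (auto simp: resolvent_power_Suc)

lemma resolvent_power_order_bounded:
  assumes "0 \<le> t" "resolvent_power t 0 ` X \<subseteq> X"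
  shows "order_bounded_op (resolvent_power t p)"
  unfolding order_bounded_op_def
proof
  fix y
  assume "y \<in> X"
  then have "resolvent_power t p (\<lambda>k. of_real (cmod (y k))) \<in> X"
    by (rule resolvent_power_in_X[OF assms(2) abs_seq_in_X])
  then show "\<exists>g\<in>X. \<forall>x\<in>X. (\<forall>n. cmod (x n) \<le> cmod (y n)) \<longrightarrow>
      (\<forall>n. cmod (resolvent_power t p x n) \<le> cmod (g n))"
    using cmod_resolvent_power_mono[OF assms(1)] by (intro bexI) auto
qed

lemma resolvent_norm_bounded:
  assumes "0 \<le> t" "resolvent_power t 0 ` X \<subseteq> X"
  obtains C where "C > 0" "\<And>x. x \<in> X \<Longrightarrow> N (resolvent_power t 0 x) \<le> C * N x"
  by (rule order_bounded_imp_norm_bounded[OF _ resolvent_power_scale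
        resolvent_power_order_bounded[OF assms, of 0]])
    (use assms(2) that in blast)+

lemma cmod_cesaro_le: "cmod (cesaro t x n) \<le> cmod (resolvent_power t 0 x n)"
proof -
  have "cmod (1 / of_nat (n + 1)) \<le> 1"
    by (simp add: norm_divide flip: of_nat_Suc)
  then show ?thesis
    unfolding cesaro_eq_resolvent norm_mult by (rule mult_left_le_one_le[rotated 2]) auto
qed

lemma cesaro_in_X:
  assumes "resolvent_power t 0 ` X \<subseteq> X" "x \<in> X"
  shows "cesaro t x \<in> X"
proof (rule solid[OF _ cmod_cesaro_le])
  show "resolvent_power t 0 x \<in> X"
    using assms by blast
qed

lemma cesaro_cont_lin_op:
  assumes "0 \<le> t" and res: "resolvent_power t 0 ` X \<subseteq> X"
  shows "cont_lin_op (cesaro t)"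
proof (rule order_bounded_imp_cont_lin_op)
  show "order_bounded_op (cesaro t)"
    using resolvent_power_order_bounded[OF assms, of 0] cmod_cesaro_le order_trans
    unfolding order_bounded_op_def by meson
qed (auto simp: cesaro_add cesaro_scale cesaro_in_X[OF res])

lemma cesaro_compact_op:
  assumes "0 \<le> t" and res: "resolvent_power t 0 ` X \<subseteq> X"
  shows "compact_op (cesaro t)"
proof -
  obtain C where C: "C > 0" "\<And>x. x \<in> X \<Longrightarrow> N (resolvent_power t 0 x) \<le> C * N x"
    using resolvent_norm_bounded[OF assms] by blast
  have eq: "cesaro t = (\<lambda>x n. 1 / of_nat (n + 1) * resolvent_power t 0 x n)"
    by (simp add: fun_eq_iff cesaro_eq_resolvent)
  have "(\<lambda>n. 1 / of_nat (n + 1) :: complex) \<longlonglongrightarrow> 0"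
    using LIMSEQ_Suc[OF lim_1_over_n[where 'a=complex]] by simp
  from null_multiplier_compact[OF _ C this] show ?thesis
    using res cesaro_cont_lin_op[OF assms] unfolding eq by blast
qed

section \<open>Spectral properties on a solid Banach lattice\<close>

lemma cont_lin_op_shifted:
  assumes "cont_lin_op T" "\<And>x. x \<in> X \<Longrightarrow> N (T x) \<le> C * N x" "C > 0"
  shows "cont_lin_op (shifted_op T \<mu>)"
proof (rule bounded_imp_cont_lin_op)
  have T: "T x \<in> X" "T (x + y) = T x + T y" "T (cscale c x) = cscale c (T x)"
    if "x \<in> X" "y \<in> X" for x y c
    using assms(1) that unfolding cont_lin_op_def by auto
  show "shifted_op T \<mu> x \<in> X" if "x \<in> X" for x
    using that T by (simp add: shifted_op_def diff_in_X scale_in_X)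
  show "shifted_op T \<mu> (x + y) = shifted_op T \<mu> x + shifted_op T \<mu> y" if "x \<in> X" "y \<in> X" for x y
    using that T by (simp add: shifted_op_def cseq.scale_right_distrib)
  show "shifted_op T \<mu> (cscale c x) = cscale c (shifted_op T \<mu> x)" if "x \<in> X" for c x
    using that T by (simp add: shifted_op_def cseq.scale_right_diff_distrib mult.commute)
  show "C + cmod \<mu> > 0"
    using assms(3) by (simp add: add_pos_nonneg)
  show "N (shifted_op T \<mu> x) \<le> (C + cmod \<mu>) * N x" if "x \<in> X" for x
    using N_diff_le[of "T x" "cscale \<mu> x"] assms(2)[OF that] that T
    by (simp add: shifted_op_def scale_in_X N_scale algebra_simps)
qed

lemma cesaro_shifted_cont_lin_op:
  assumes "0 \<le> t" "resolvent_power t 0 ` X \<subseteq> X"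
  shows "cont_lin_op (shifted_op (cesaro t) \<mu>)"
proof -
  obtain C where C: "C > 0" "\<And>x. x \<in> X \<Longrightarrow> N (resolvent_power t 0 x) \<le> C * N x"
    using resolvent_norm_bounded[OF assms] by blast
  have "N (cesaro t x) \<le> C * N x" if "x \<in> X" for x
  proof -
    have "N (cesaro t x) \<le> N (resolvent_power t 0 x)"
      using assms(2) that by (intro N_mono cesaro_in_X cmod_cesaro_le) auto
    with C(2)[OF that] show ?thesis
      by linarith
  qed
  then show ?thesis
    using cesaro_cont_lin_op[OF assms] C(1) by (intro cont_lin_op_shifted)
qed

lemma cesaro_shifted_inj:
  assumes "\<mu> \<notin> Lambda"
  shows "shifted_op (cesaro t) \<mu> x = shifted_op (cesaro t) \<mu> y \<Longrightarrow> x = y"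
proof (rule ccontr)
  assume eq: "shifted_op (cesaro t) \<mu> x = shifted_op (cesaro t) \<mu> y" and "x \<noteq> y"
  have "cesaro t (x - y) = cesaro t x - cesaro t y"
    using cesaro_add[of t "x - y" y] by simp
  also have "\<dots> = cscale \<mu> (x - y)"
    using eq by (simp add: shifted_op_def cseq.scale_right_diff_distrib algebra_simps)
  finally show False
    using cesaro_eigenvalue_in_Lambda[of t "x - y" \<mu>] \<open>x \<noteq> y\<close> assms by simp
qed

text \<open>
  The solution operator is dominated by \<open>G\<close>, which depends monotonically on the moduli. This gives both
  that it maps \<open>X\<close> into \<open>X\<close> and that it is order bounded, hence continuous.
\<close>

lemma cesaro_shifted_invertible:
  assumes t: "0 \<le> t" and res: "resolvent_power t 0 ` X \<subseteq> X"
    and \<mu>: "\<mu> \<notin> Lambda \<union> {0}"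
  shows "invertible_op (shifted_op (cesaro t) \<mu>)"
proof -
  let ?T = "shifted_op (cesaro t) \<mu>"
  obtain C p where C: "0 < C" and ex: "\<And>y. \<exists>x. cesaro t x - cscale \<mu> x = y \<and>
      (\<forall>n. cmod (x n) \<le> C * (cmod (resolvent_power t p (\<lambda>k. of_real (cmod (y k))) n) + cmod (y n)))"
    using cesaro_solution[OF t \<mu>] by metis
  from ex obtain R where R: "\<And>y. ?T (R y) = y"
    and R_le: "\<And>y n. cmod (R y n) \<le> C * (cmod (resolvent_power t p (\<lambda>k. of_real (cmod (y k))) n) + cmod (y n))"
    unfolding shifted_op_def by metis
  have inj: "x = y" if "?T x = ?T y" for x y
    using cesaro_shifted_inj \<mu> that by blast
  have T_add: "?T (x + y) = ?T x + ?T y" for x y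
    by (simp add: shifted_op_def cesaro_add cseq.scale_right_distrib)
  have T_scale: "?T (cscale c x) = cscale c (?T x)" for c x
    by (simp add: shifted_op_def cesaro_scale cseq.scale_right_diff_distrib mult.commute)
  define G where "G y = (\<lambda>n. of_real (C * (cmod (resolvent_power t p (\<lambda>k. of_real (cmod (y k))) n) + cmod (y n))) :: complex)" for y
  have G: "G y \<in> X" if "y \<in> X" for y
  proof -
    have "G y = cscale (of_real C) ((\<lambda>n. of_real (cmod (resolvent_power t p (\<lambda>k. of_real (cmod (y k))) n)))
        + (\<lambda>n. of_real (cmod (y n))))"
      by (simp add: G_def cscale_def fun_eq_iff)
    then show ?thesis
      using scale_in_X[OF add_in_X[OF abs_seq_in_X[OF resolvent_power_in_X[OF res abs_seq_in_X[OF that]]]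
            abs_seq_in_X[OF that]]] by simp
  qed
  have R_le_G: "cmod (R x n) \<le> cmod (G y n)" if "\<And>n. cmod (x n) \<le> cmod (y n)" for x y n
  proof -
    have "cmod (resolvent_power t p (\<lambda>k. of_real (cmod (x k))) n)
        \<le> cmod (resolvent_power t p (\<lambda>k. of_real (cmod (y k))) n)"
      using t that by (intro cmod_resolvent_power_mono) auto
    then have "C * (cmod (resolvent_power t p (\<lambda>k. of_real (cmod (x k))) n) + cmod (x n))
        \<le> C * (cmod (resolvent_power t p (\<lambda>k. of_real (cmod (y k))) n) + cmod (y n))"
      using C that[of n] by (intro mult_left_mono add_mono) auto
    with R_le[of x n] have "cmod (R x n) \<le> C * (cmod (resolvent_power t p (\<lambda>k. of_real (cmod (y k))) n) + cmod (y n))"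
      by (rule order_trans)
    also have "\<dots> = cmod (G y n)"
      unfolding G_def norm_of_real using C by simp
    finally show ?thesis .
  qed
  have "cont_lin_op R"
  proof (rule order_bounded_imp_cont_lin_op)
    show "R x \<in> X" if "x \<in> X" for x
      by (rule solid[OF G[OF that] R_le_G]) simp
    show "R (x + y) = R x + R y" for x y
      by (rule inj) (simp add: R T_add)
    show "R (cscale c x) = cscale c (R x)" for c x
      by (rule inj) (simp add: R T_scale)
    show "order_bounded_op R"
      unfolding order_bounded_op_def using G R_le_G by blast
  qed
  moreover have "R (?T x) = x" for x
    by (rule inj) (simp add: R)
  ultimately show ?thesis
    unfolding invertible_op_def using cesaro_shifted_cont_lin_op[OF t res] R by blast
qed

lemma cesaro_not_inj_on:
  assumes "resolvent_power t 0 ` X \<subseteq> X" and "\<mu> \<in> Lambda"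
  shows "\<not> inj_on (shifted_op (cesaro t) \<mu>) X"
proof -
  obtain n where \<mu>: "\<mu> = 1 / of_nat (n + 1)"
    using assms(2) by (auto simp: Lambda_def)
  let ?v = "resolvent_power t n (unit_seq n)"
  have v: "?v \<in> X"
    by (rule resolvent_power_in_X[OF assms(1) unit_seq_in_X])
  have "?v n \<noteq> 0"
    by (simp add: resolvent_power_unit_seq)
  then have "?v \<noteq> 0"
    by (metis zero_fun_apply)
  moreover have "shifted_op (cesaro t) \<mu> ?v = shifted_op (cesaro t) \<mu> 0"
    using cesaro_eigenvector[of t n] cesaro_scale[of t 0 0] by (simp add: shifted_op_def \<mu>)
  ultimately show ?thesis
    using v zero_in_X by (meson inj_onD)
qed

text \<open>
  Writing \<open>y = cesaro t x\<close> gives \<open>(n + 1) * y n = (R x) n\<close>. So if \<open>cesaro t\<close> were onto, multiplication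
  by \<open>n + 1\<close> would map \<open>X\<close> into itself. Being a positive
  operator it would be bounded, but its eigenvalues \<open>n + 1\<close> are not.
\<close>

lemma cesaro_not_onto:
  assumes res: "resolvent_power t 0 ` X \<subseteq> X"
  shows "\<not> X \<subseteq> cesaro t ` X"
proof
  assume onto: "X \<subseteq> cesaro t ` X"
  define M :: "cseq \<Rightarrow> cseq" where "M y = (\<lambda>n. of_nat (n + 1) * y n)" for y
  have M: "M y \<in> X" if y: "y \<in> X" for y
  proof -
    obtain x where "x \<in> X" "y = cesaro t x"
      using onto y by blast
    moreover from this have "M y = resolvent_power t 0 x"
      by (simp add: M_def fun_eq_iff cesaro_eq_resolvent del: of_nat_Suc)
    ultimately show ?thesis
      using res by blast
  qed
  have M_scale: "M (cscale c y) = cscale c (M y)" for c y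
    by (simp add: M_def cscale_def fun_eq_iff)
  have "order_bounded_op M"
    unfolding order_bounded_op_def
  proof
    show "\<exists>g\<in>X. \<forall>x\<in>X. (\<forall>n. cmod (x n) \<le> cmod (y n)) \<longrightarrow> (\<forall>n. cmod (M x n) \<le> cmod (g n))"
      if "y \<in> X" for y
      using M[OF that] by (intro bexI[of _ "M y"]) (auto simp: M_def norm_mult mult_left_mono)
  qed
  then obtain C where C: "\<And>x. x \<in> X \<Longrightarrow> N (M x) \<le> C * N x"
    using order_bounded_imp_norm_bounded[of M] M M_scale by metis
  obtain n where n: "C < real n"
    using reals_Archimedean2 by blast
  have "M (unit_seq n) = cscale (of_nat (n + 1)) (unit_seq n)"
    by (auto simp: M_def cscale_def unit_seq_def)
  then have "N (M (unit_seq n)) = cmod (of_nat (n + 1)) * N (unit_seq n)"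
    using N_scale unit_seq_in_X by metis
  then have "real (n + 1) * N (unit_seq n) \<le> C * N (unit_seq n)"
    using C[OF unit_seq_in_X, of n] by (simp only: norm_of_nat)
  then show False
    using n N_unit_seq_pos[of n] by simp
qed

text \<open>
  The preimage comes from \<open>R (e\<^sub>n - t e\<^sub>n\<^sub>+\<^sub>1) = e\<^sub>n\<close> and \<open>D e\<^sub>n = e\<^sub>n / (n + 1)\<close>.
\<close>

lemma cesaro_range_contains_unit_seq: "unit_seq n \<in> cesaro t ` X"
proof
  let ?x = "cscale (of_nat (n + 1)) (unit_seq n - cscale (of_real t) (unit_seq (Suc n)))"
  show "?x \<in> X"
    by (intro scale_in_X diff_in_X unit_seq_in_X)
  have "cscale (of_nat (n + 1)) (unit_seq n) = resolvent_power t 0 ?x"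
    by (rule resolvent_0_unique) (auto simp: cscale_def unit_seq_def)
  then have "cesaro t ?x m = 1 / of_nat (m + 1) * (cscale (of_nat (n + 1)) (unit_seq n)) m" for m
    by (simp add: cesaro_eq_resolvent)
  then show "unit_seq n = cesaro t ?x"
    by (auto simp: fun_eq_iff cscale_def unit_seq_def simp del: of_nat_Suc)
qed

lemma natural_basis_dense:
  assumes "natural_basis" "T ` X \<subseteq> X" "\<And>n. unit_seq n \<in> T ` X"
    and "\<And>x y. x \<in> X \<Longrightarrow> y \<in> X \<Longrightarrow> T (x + y) = T x + T y"
    and "\<And>c x. x \<in> X \<Longrightarrow> T (cscale c x) = cscale c (T x)"
  shows "mtopology closure_of (T ` X) = X"
proof (intro antisym subsetI)
  show "x \<in> X" if "x \<in> mtopology closure_of (T ` X)" for x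
    using that closure_of_subset_topspace by fastforce
  have scale: "cscale c y \<in> T ` X" if "y \<in> T ` X" for c y
    using that assms(5) scale_in_X by (metis (no_types, lifting) image_iff)
  have add: "y + z \<in> T ` X" if "y \<in> T ` X" "z \<in> T ` X" for y z
    using that assms(4) add_in_X by (metis (no_types, lifting) image_iff)
  have "cscale 0 (unit_seq 0) \<in> T ` X"
    by (intro scale assms(3))
  then have zero: "0 \<in> T ` X"
    by simp
  have partial: "(\<Sum>n<m. cscale (a n) (unit_seq n)) \<in> T ` X" for a m
    by (induction m) (simp_all only: lessThan_0 sum.empty zero sum.lessThan_Suc add scale assms(3))
  show "x \<in> mtopology closure_of (T ` X)" if x: "x \<in> X" for x
  proof -
    obtain a where "limitin mtopology (\<lambda>m. \<Sum>n<m. cscale (a n) (unit_seq n)) x sequentially"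
      using assms(1) x unfolding natural_basis_def by blast
    moreover have "range (\<lambda>m. \<Sum>n<m. cscale (a n) (unit_seq n)) \<subseteq> T ` X \<inter> X"
      by (intro image_subsetI IntI partial subsetD[OF assms(2) partial])
    ultimately show ?thesis
      unfolding closure_of_sequentially using x by (intro CollectI conjI exI)
  qed
qed

lemma spectra_of_cesaro:
  assumes t: "0 \<le> t" and res: "resolvent_power t 0 ` X \<subseteq> X"
    and basis: natural_basis
  shows "spectrum (cesaro t) = Lambda \<union> {0}"
    and "point_spectrum (cesaro t) = Lambda"
    and "continuous_spectrum (cesaro t) = {0}"
    and "residual_spectrum (cesaro t) = {}"
proof -
  let ?T = "shifted_op (cesaro t)"
  have shift_0: "?T 0 = cesaro t"
    by (simp add: shifted_op_def fun_eq_iff)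
  have inj_iff: "inj_on (?T \<mu>) X \<longleftrightarrow> \<mu> \<notin> Lambda" for \<mu>
    using cesaro_not_inj_on[OF res] cesaro_shifted_inj by (meson inj_onI)
  have onto: "?T \<mu> ` X = X" if "invertible_op (?T \<mu>)" for \<mu>
    using that unfolding invertible_op_def cont_lin_op_def by (auto simp: image_iff) (metis image_eqI subsetD)
  have inj: "inj_on (?T \<mu>) X" if "invertible_op (?T \<mu>)" for \<mu>
    using that unfolding invertible_op_def by (metis inj_onI)
  have maps: "cesaro t ` X \<subseteq> X"
    using cesaro_in_X res by blast
  have not_onto: "cesaro t ` X \<subset> X"
    using cesaro_not_onto[OF res] maps by blast
  have dense: "mtopology closure_of (cesaro t ` X) = X"
    by (intro natural_basis_dense basis maps cesaro_range_contains_unit_seq cesaro_add cesaro_scale)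
  have inv_iff: "invertible_op (?T \<mu>) \<longleftrightarrow> \<mu> \<notin> Lambda \<union> {0}" for \<mu>
    using cesaro_shifted_invertible[OF t res] onto[of 0] inj inj_iff not_onto shift_0 by auto
  show "spectrum (cesaro t) = Lambda \<union> {0}"
    unfolding spectrum_def inv_iff by blast
  show "point_spectrum (cesaro t) = Lambda"
    unfolding point_spectrum_def inj_iff by blast
  have closed: "mtopology closure_of X = X"
    by (metis closure_of_topspace topspace_mtopology)
  have cases: "\<mu> = 0 \<or> ?T \<mu> ` X = X" if "\<mu> \<notin> Lambda" for \<mu>
    using onto inv_iff that by blast
  show "continuous_spectrum (cesaro t) = {0}"
    unfolding continuous_spectrum_def inj_iff
    using cases zero_notin_Lambda not_onto dense by (auto simp: shift_0)
  show "residual_spectrum (cesaro t) = {}"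
    unfolding residual_spectrum_def inj_iff using cases closed dense shift_0 by force
qed

end

theorem theorem3p7:
  fixes t :: real and X :: "cseq set" and N :: "cseq \<Rightarrow> real"
  assumes "0 \<le> t" and "t < 1"
    and "solid_banach_lattice X N"
    and "normed_seq_space.natural_basis X N"
    and "normed_seq_space.translation_invariant X"
    and "d1 \<subseteq> X"
    and "\<And>x. x \<in> X \<Longrightarrow>
      normed_seq_space.series_converges X N (\<lambda>n. cscale (of_real t ^ n) ((right_shift ^^ n) x))"
  shows "normed_seq_space.cont_lin_op X N (cesaro t) \<and>
    normed_seq_space.compact_op X N (cesaro t) \<and>
    normed_seq_space.spectrum X N (cesaro t) = Lambda \<union> {0} \<and>
    normed_seq_space.point_spectrum X (cesaro t) = Lambda \<and>
    normed_seq_space.continuous_spectrum X N (cesaro t) = {0} \<and>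
    normed_seq_space.residual_spectrum X N (cesaro t) = {}"
proof -
  interpret solid_banach_lattice X N
    by fact
  have res: "resolvent_power t 0 ` X \<subseteq> X"
    by (intro image_subsetI resolvent_in_X assms(7))
  show ?thesis
    using cesaro_cont_lin_op[OF assms(1) res] cesaro_compact_op[OF assms(1) res]
      spectra_of_cesaro[OF assms(1) res assms(4)] by blast
qed

end
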